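(* For any non-negative integer $N$, $$\begin{aligned} Rp(3,3,4;2N)&=rP(3,1,1;N)-2\,rtg(3,6,1;N-1),\\ Rp(3,3,4;4N+3)&=4\,tpg(3,2,1;N),\\ Rp(3,3,4;4N+1)&=0. \end{aligned}$$
   Context: $\mathbb{N}_0=\{0,1,2,\dots\}$. $t_n=n(n+1)/2$ (triangular numbers, $n\in\mathbb{N}_0$), $p_n=n(3n+1)/2$ (generalized pentagonal numbers, $n\in\mathbb{Z}$), $g_n=n(3n+2)$ (generalized octagonal numbers, $n\in\mathbb{Z}$). For positive integers $a_1,a_2,a_3$ and an integer $N$: $Rp(a_1,a_2,a_3;N)=|\{(l,m,n)\in\mathbb{Z}^3: N=a_1l^2+a_2m^2+a_3p_n\}|$; $rP(a_1,a_2,a_3;N)=|\{(l,m,n)\in\mathbb{Z}^3: N=a_1l^2+a_2p_m+a_3p_n\}|$; $rtg(a_1,a_2,a_3;N)=|\{(l,m,n)\in\mathbb{Z}\times\mathbb{N}_0\times\mathbb{Z}: N=a_1l^2+a_2t_m+a_3g_n\}|$; $tpg(a_1,a_2,a_3;N)=|\{(l,m,n)\in\mathbb{N}_0\times\mathbb{Z}^2: N=a_1t_l+a_2p_m+a_3g_n\}|$. In particular these counts are $0$ when $N<0$. *)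

theory Defs
  imports Main
begin

text \<open>All divisions by 2 below are exact.\<close>

definition triangular :: "nat \<Rightarrow> int" where
  "triangular n = int n * (int n + 1) div 2"

definition pentagonal :: "int \<Rightarrow> int" where
  "pentagonal n = n * (3 * n + 1) div 2"

definition octagonal :: "int \<Rightarrow> int" where
  "octagonal n = n * (3 * n + 2)"

text \<open>
  The coefficients are meant to be positive. In that case each of the following sets is finite,
  and it is empty for negative \<open>N\<close>, so that \<open>card\<close> is the true number of representations.
  The target \<open>N\<close> is an integer because \<open>N - 1\<close> may be \<open>-1\<close>.
\<close>

definition Rp :: "int \<Rightarrow> int \<Rightarrow> int \<Rightarrow> int \<Rightarrow> nat" where
  "Rp a1 a2 a3 N =
     card {(l :: int, m :: int, n :: int). N = a1 * l\<^sup>2 + a2 * m\<^sup>2 + a3 * pentagonal n}"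

definition rP :: "int \<Rightarrow> int \<Rightarrow> int \<Rightarrow> int \<Rightarrow> nat" where
  "rP a1 a2 a3 N =
     card {(l :: int, m :: int, n :: int). N = a1 * l\<^sup>2 + a2 * pentagonal m + a3 * pentagonal n}"

definition rtg :: "int \<Rightarrow> int \<Rightarrow> int \<Rightarrow> int \<Rightarrow> nat" where
  "rtg a1 a2 a3 N =
     card {(l :: int, m :: nat, n :: int). N = a1 * l\<^sup>2 + a2 * triangular m + a3 * octagonal n}"

definition tpg :: "int \<Rightarrow> int \<Rightarrow> int \<Rightarrow> int \<Rightarrow> nat" where
  "tpg a1 a2 a3 N =
     card {(l :: nat, m :: int, n :: int). N = a1 * triangular l + a2 * pentagonal m + a3 * octagonal n}"

end

theory Submission
  imports Defs
begin

text \<open>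
  Each identity comes from linear substitutions in pairs of variables. The substitution
  \<open>(x, y) \<mapsto> (x + y, x - y)\<close> reaches the pairs of even sum and \<open>(x, y) \<mapsto> (x + y + 1, x - y)\<close> those of
  odd sum. Applied to the two squares they give \<open>\<phi>(q)\<^sup>2 = \<phi>(q\<^sup>2)\<^sup>2 + 4 q \<psi>(q\<^sup>4)\<^sup>2\<close>, and applied to
  two pentagonal indices they give \<open>P(q)\<^sup>2 = \<phi>(q\<^sup>3) P(q\<^sup>2) + 2 q \<psi>(q\<^sup>6) G(q)\<close>, where
  \<open>\<phi>\<close>, \<open>\<psi>\<close>, \<open>P\<close> and \<open>G\<close> generate the squares, triangular, pentagonal and octagonal numbers.
  The identity \<open>\<psi>(q\<^sup>3) P(q) = P(q\<^sup>2) G(q)\<close> uses that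
  the symmetry \<open>j \<mapsto> -1 - j\<close> of the triangular numbers reverses the parity of \<open>j\<close>, so that one
  representative of each orbit can be chosen with the parity of the pentagonal index.
\<close>

text \<open>The linear substitutions run over all integers, so triangular numbers are needed at
  negative indices as well.\<close>

definition int_triangular :: "int \<Rightarrow> int" where
  "int_triangular z = z * (z + 1) div 2"

text \<open>The bit selects one of the two members of an orbit of the symmetry of
  \<open>int_triangular\<close>. For each fixed bit the map is an involution.\<close>

definition reflect :: "bool \<Rightarrow> int \<Rightarrow> int" where
  "reflect b z = (if b then - 1 - z else z)"

lemma triangular_eq: "triangular n = int_triangular (int n)"
  by (simp add: triangular_def int_triangular_def)

lemma two_int_triangular: "2 * int_triangular z = z\<^sup>2 + z"
  by (simp add: int_triangular_def power2_eq_square algebra_simps)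

lemma two_pentagonal: "2 * pentagonal n = 3 * n\<^sup>2 + n"
proof -
  have "even (n * (3 * n + 1))" by simp
  then show ?thesis
    unfolding pentagonal_def by (simp add: power2_eq_square algebra_simps)
qed

lemma int_triangular_reflect [simp]: "int_triangular (reflect b z) = int_triangular z"
  by (simp add: int_triangular_def reflect_def algebra_simps)

text \<open>Every orbit has exactly one nonnegative member. Trading an integer index for a natural
  one thus costs one free bit, and each such bit doubles a count.\<close>

lemma bij_reflect_int: "bij (\<lambda>(b, n). reflect b (int n))"
proof (rule bijI)
  show "inj (\<lambda>(b, n). reflect b (int n))"
    by (auto simp: inj_def reflect_def split: if_splits)
  have "z = (\<lambda>(b, n). reflect b (int n)) (z < 0, nat (if z < 0 then - 1 - z else z))" for z
    by (simp add: reflect_def)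
  then show "surj (\<lambda>(b, n). reflect b (int n))"
    by (rule surjI[OF sym])
qed

section \<open>Quadratic identities behind the substitutions\<close>

lemma int_triangular_pythagoras:
  "(x + y + 1)\<^sup>2 + (x - y)\<^sup>2 = 4 * int_triangular x + 4 * int_triangular y + 1"
  using two_int_triangular[of x] two_int_triangular[of y]
  by (simp add: power2_eq_square algebra_simps)

lemma pentagonal_add_even:
  "pentagonal (x + y) + pentagonal (x - y) = 3 * y\<^sup>2 + 2 * pentagonal x"
  using two_pentagonal[of "x + y"] two_pentagonal[of "x - y"] two_pentagonal[of x]
  by (simp add: power2_eq_square algebra_simps)

text \<open>With 24 p_n + 1 = (6n+1)^2, 8 t_n + 1 = (2n+1)^2 and 3 g_n + 1 = (3n+1)^2, this is the
  parallelogram law for 6y + 3 and 6x + 2.\<close>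

lemma pentagonal_add_odd:
  "pentagonal (y - x) + pentagonal (- 1 - x - y) = 6 * int_triangular y + octagonal x + 1"
  using two_pentagonal[of "y - x"] two_pentagonal[of "- 1 - x - y"] two_int_triangular[of y]
  by (simp add: octagonal_def power2_eq_square algebra_simps)

text \<open>After completing squares in the same way, this is the parallelogram law for 6y + 2 and
  6x + 1.\<close>

lemma int_triangular_add_pentagonal:
  "3 * int_triangular (x + y) + pentagonal (y - x) = 2 * pentagonal x + octagonal y"
  using two_pentagonal[of "y - x"] two_pentagonal[of x] two_int_triangular[of "x + y"]
  by (simp add: octagonal_def power2_eq_square algebra_simps)

section \<open>Finiteness and transport of cardinalities\<close>

lemma abs_le_square: "\<bar>z\<bar> \<le> z\<^sup>2" for z :: int
  using mult_left_mono[of 1 "\<bar>z\<bar>" "\<bar>z\<bar>"] by (cases "z = 0") (auto simp: power2_eq_square)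

lemma abs_le_pentagonal: "\<bar>n\<bar> \<le> pentagonal n"
  using two_pentagonal[of n] abs_le_square[of n] by linarith

text \<open>The substitution need not be surjective: it suffices that it reaches all solutions,
  which a parity condition on them can ensure.\<close>

lemma card_substitution:
  assumes "inj f" and "\<And>y. Q y \<Longrightarrow> y \<in> range f"
  shows "card {y. Q y} = card {x. Q (f x)}"
proof -
  have "Collect Q \<subseteq> range f" using assms(2) by auto
  from card_vimage_inj[OF assms(1) this] show ?thesis by (simp add: vimage_def)
qed

lemma card_bool_times: "card {(b :: bool, x). P x} = 2 * card {x. P x}"
proof -
  have "{(b :: bool, x). P x} = UNIV \<times> {x. P x}" by auto
  then show ?thesis by (simp add: card_cartesian_product)
qed

text \<open>Needed to add the sizes of two parts of the solution set, since \<open>card\<close> of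
  an infinite set is 0. No summand is negative, so each is at most \<open>N\<close> and bounds its
  variable.\<close>

lemma finite_rP:
  assumes "a > 0" "b > 0" "c > 0"
  shows "finite {(l, m, n). N = a * l\<^sup>2 + b * pentagonal m + c * pentagonal n}"
proof (rule finite_subset)
  have le: "x \<le> d * x" if "d > 0" "x \<ge> 0" for d x :: int
    using mult_right_mono[of 1 d x] that by simp
  have "l \<in> {- N..N} \<and> m \<in> {- N..N} \<and> n \<in> {- N..N}"
    if "N = a * l\<^sup>2 + b * pentagonal m + c * pentagonal n" for l m n
  proof -
    have "l\<^sup>2 \<le> a * l\<^sup>2" "pentagonal m \<le> b * pentagonal m"
      "pentagonal n \<le> c * pentagonal n"
      using assms abs_le_pentagonal[of m] abs_le_pentagonal[of n] by (auto intro!: le)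
    then show ?thesis
      using that abs_le_square[of l] abs_le_pentagonal[of m] abs_le_pentagonal[of n] by auto
  qed
  then show "{(l, m, n). N = a * l\<^sup>2 + b * pentagonal m + c * pentagonal n}
    \<subseteq> {- N..N} \<times> {- N..N} \<times> {- N..N}"
    by blast
qed auto

section \<open>Representation counts split by parity\<close>

lemma even_sum_in_range:
  fixes l m :: int
  assumes "even (l + m)"
  obtains x y where "l = x + y" "m = x - y"
proof
  show "l = (l + m) div 2 + (l - m) div 2" "m = (l + m) div 2 - (l - m) div 2"
    using assms by presburger+
qed

lemma odd_sum_in_range:
  fixes l m :: int
  assumes "odd (l + m)"
  obtains x y where "l = x + y + 1" "m = x - y"
  using even_sum_in_range[of "l - 1" m] assms
  by (metis add_diff_cancel_right' diff_add_cancel diff_add_eq even_add odd_one)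

text \<open>Modulo 2 the equation forces \<open>l + m\<close> to be even. The substitution then
  doubles the sum of squares, and the common factor 2 cancels.\<close>

lemma Rp_even:
  assumes "odd a"
  shows "Rp a a (2 * b) (2 * N) = Rp a a b N"
proof -
  let ?f = "\<lambda>(x, y, n). (x + y, x - y, n) :: int \<times> int \<times> int"
  have "Rp a a (2 * b) (2 * N) = card {t. case ?f t of
      (l, m, n) \<Rightarrow> 2 * N = a * l\<^sup>2 + a * m\<^sup>2 + 2 * b * pentagonal n}"
    unfolding Rp_def
  proof (rule card_substitution)
    show "inj ?f" by (auto simp: inj_def)
    fix t assume "case t of (l, m, n) \<Rightarrow> 2 * N = a * l\<^sup>2 + a * m\<^sup>2 + 2 * b * pentagonal n"
    then obtain l m n where t: "t = (l, m, n)"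
      and eq: "2 * N = a * l\<^sup>2 + a * m\<^sup>2 + 2 * b * pentagonal n" by auto
    have "even (a * l\<^sup>2 + a * m\<^sup>2 + 2 * b * pentagonal n)" by (simp flip: eq)
    then have "even (l + m)" using assms by simp
    then obtain x y where "l = x + y" "m = x - y" by (rule even_sum_in_range)
    then have "t = ?f (x, y, n)" by (simp add: t)
    then show "t \<in> range ?f" by (rule range_eqI)
  qed
  also have "\<dots> = Rp a a b N"
    unfolding Rp_def
  proof (intro arg_cong[where f = card] Collect_cong, clarsimp)
    fix x y n :: int
    have "a * (x + y)\<^sup>2 + a * (x - y)\<^sup>2 + 2 * b * pentagonal n
      = 2 * (a * x\<^sup>2 + a * y\<^sup>2 + b * pentagonal n)"
      by (simp add: power2_eq_square algebra_simps)
    then show "2 * N = a * (x + y)\<^sup>2 + a * (x - y)\<^sup>2 + 2 * b * pentagonal n \<longleftrightarrow>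
        N = a * x\<^sup>2 + a * y\<^sup>2 + b * pentagonal n"
      by (metis mult_cancel_left zero_neq_numeral)
  qed
  finally show ?thesis .
qed

text \<open>Here \<open>l + m\<close> is odd, so the two squares sum to 1 modulo 4. This accounts
  for the summand \<open>a\<close> of the target, and the factor 4 cancels from the rest.\<close>

lemma Rp_odd:
  assumes "odd a"
  shows "Rp a a (4 * b) (4 * N + a) =
    card {(x, y, n). N = a * int_triangular x + a * int_triangular y + b * pentagonal n}"
proof -
  let ?f = "\<lambda>(x, y, n). (x + y + 1, x - y, n) :: int \<times> int \<times> int"
  have "Rp a a (4 * b) (4 * N + a) = card {t. case ?f t of
      (l, m, n) \<Rightarrow> 4 * N + a = a * l\<^sup>2 + a * m\<^sup>2 + 4 * b * pentagonal n}"
    unfolding Rp_def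
  proof (rule card_substitution)
    show "inj ?f" by (auto simp: inj_def)
    fix t assume "case t of (l, m, n) \<Rightarrow> 4 * N + a = a * l\<^sup>2 + a * m\<^sup>2 + 4 * b * pentagonal n"
    then obtain l m n where t: "t = (l, m, n)"
      and eq: "4 * N + a = a * l\<^sup>2 + a * m\<^sup>2 + 4 * b * pentagonal n" by auto
    have "odd (a * l\<^sup>2 + a * m\<^sup>2 + 4 * b * pentagonal n)" using assms by (simp flip: eq)
    then have "odd (l + m)" using assms by simp
    then obtain x y where "l = x + y + 1" "m = x - y" by (rule odd_sum_in_range)
    then have "t = ?f (x, y, n)" by (simp add: t)
    then show "t \<in> range ?f" by (rule range_eqI)
  qed
  also have "\<dots> = card {(x, y, n).
      N = a * int_triangular x + a * int_triangular y + b * pentagonal n}"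
  proof (intro arg_cong[where f = card] Collect_cong, clarsimp)
    fix x y n :: int
    have "a * (x + y + 1)\<^sup>2 + a * (x - y)\<^sup>2 + 4 * b * pentagonal n
      = a * ((x + y + 1)\<^sup>2 + (x - y)\<^sup>2) + 4 * b * pentagonal n"
      by (simp add: distrib_left)
    also have "\<dots> = 4 * (a * int_triangular x + a * int_triangular y + b * pentagonal n) + a"
      unfolding int_triangular_pythagoras by (simp add: algebra_simps)
    finally show "4 * N + a = a * (x + y + 1)\<^sup>2 + a * (x - y)\<^sup>2 + 4 * b * pentagonal n \<longleftrightarrow>
        N = a * int_triangular x + a * int_triangular y + b * pentagonal n"
      by (metis add_right_cancel mult_cancel_left zero_neq_numeral)
  qed
  finally show ?thesis .
qed

text \<open>Split by the parity of \<open>m + n\<close>: the even part gives \<open>Rp\<close>, the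
  odd part gives \<open>rtg\<close>, doubled by the reflection bit.\<close>

lemma rP_eq_Rp_add_rtg:
  assumes "a > 0" "b > 0"
  shows "rP a b b N = Rp a (3 * b) (2 * b) N + 2 * rtg a (6 * b) b (N - b)"
proof -
  define Q where "Q = (\<lambda>(l, m, n). N = a * l\<^sup>2 + b * pentagonal m + b * pentagonal n)"
  have fin: "finite {t. Q t}"
    unfolding Q_def using finite_rP[of a b b N] assms by simp
  define ev where "ev = (\<lambda>(l :: int, m, n). even (m + n :: int))"
  have "rP a b b N = card ({t. Q t \<and> ev t} \<union> {t. Q t \<and> \<not> ev t})"
    unfolding rP_def Q_def by (rule arg_cong[where f = card]) auto
  also have "\<dots> = card {t. Q t \<and> ev t} + card {t. Q t \<and> \<not> ev t}"
    by (rule card_Un_disjoint) (auto intro: finite_subset[OF _ fin])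
  also have "card {t. Q t \<and> ev t} = Rp a (3 * b) (2 * b) N"
  proof -
    let ?f = "\<lambda>(l, y, x). (l, x + y, x - y) :: int \<times> int \<times> int"
    have "card {t. Q t \<and> ev t} = card {t. Q (?f t) \<and> ev (?f t)}"
    proof (rule card_substitution)
      show "inj ?f" by (auto simp: inj_def)
      fix t assume "Q t \<and> ev t"
      moreover obtain l m n where t: "t = (l, m, n)" by (cases t)
      ultimately have "even (m + n)" by (simp add: ev_def)
      then obtain x y where "m = x + y" "n = x - y" by (rule even_sum_in_range)
      then have "t = ?f (l, y, x)" by (simp add: t)
      then show "t \<in> range ?f" by (rule range_eqI)
    qed
    also have "\<dots> = Rp a (3 * b) (2 * b) N"
      unfolding Rp_def
    proof (intro arg_cong[where f = card] Collect_cong, clarsimp simp: Q_def ev_def)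
      fix l y x :: int
      have "b * pentagonal (x + y) + b * pentagonal (x - y) = b * (3 * y\<^sup>2 + 2 * pentagonal x)"
        by (simp only: distrib_left flip: pentagonal_add_even)
      then show "N = a * l\<^sup>2 + b * pentagonal (x + y) + b * pentagonal (x - y) \<longleftrightarrow>
          N = a * l\<^sup>2 + 3 * b * y\<^sup>2 + 2 * b * pentagonal x"
        by (intro iffI; simp add: algebra_simps)
    qed
    finally show ?thesis .
  qed
  also have "card {t. Q t \<and> \<not> ev t} = 2 * rtg a (6 * b) b (N - b)"
  proof -
    \<comment> \<open>This is the substitution for odd sums with x replaced by -1 - x, which turns
      3x^2 + 4x + 1 into \<open>octagonal x\<close>.\<close>
    let ?f = "\<lambda>(r, l, j, x). (l, reflect r (int j) - x, - 1 - x - reflect r (int j))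
      :: int \<times> int \<times> int"
    have "card {t. Q t \<and> \<not> ev t} = card {t. Q (?f t) \<and> \<not> ev (?f t)}"
    proof (rule card_substitution)
      have *: "r = r' \<and> j = j' \<and> x = x'"
        if "reflect r (int j) - x = reflect r' (int j') - x'"
          "- 1 - x - reflect r (int j) = - 1 - x' - reflect r' (int j')"
        for r r' j j' x x'
      proof -
        have "x = x'" "reflect r (int j) = reflect r' (int j')" using that by auto
        then show ?thesis
          using injD[OF bij_is_inj[OF bij_reflect_int], of "(r, j)" "(r', j')"] by simp
      qed
      show "inj ?f"
        by (simp only: inj_def split_paired_All prod.case prod.inject)
          (intro allI impI, elim conjE, drule (1) *, simp)
      fix t assume "Q t \<and> \<not> ev t"
      moreover obtain l m n where t: "t = (l, m, n)" by (cases t)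
      ultimately have "odd (m + n)" by (simp add: ev_def)
      then obtain x y where mn: "m = x + y + 1" "n = x - y" by (rule odd_sum_in_range)
      obtain r j where "y = reflect r (int j)"
        using bij_is_surj[OF bij_reflect_int] by (auto dest: surjD[of _ y])
      then have "t = ?f (r, l, j, - 1 - x)" by (simp add: t mn)
      then show "t \<in> range ?f" by (rule range_eqI)
    qed
    also have "\<dots> = card {(r :: bool, t). case t of
        (l, j, x) \<Rightarrow> N - b = a * l\<^sup>2 + 6 * b * triangular j + b * octagonal x}"
    proof (intro arg_cong[where f = card] Collect_cong, simp only: split_paired_all prod.case)
      fix r l j x
      have "\<not> ev (l, reflect r (int j) - x, - 1 - x - reflect r (int j))"
        by (auto simp: ev_def)
      moreover have "b * pentagonal (reflect r (int j) - x) + b * pentagonal (- 1 - x - reflect r (int j))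
          = b * (6 * triangular j + octagonal x + 1)"
        using pentagonal_add_odd[of "reflect r (int j)" x]
        by (simp add: triangular_eq flip: distrib_left)
      ultimately show "Q (l, reflect r (int j) - x, - 1 - x - reflect r (int j)) \<and>
            \<not> ev (l, reflect r (int j) - x, - 1 - x - reflect r (int j)) \<longleftrightarrow>
          N - b = a * l\<^sup>2 + 6 * b * triangular j + b * octagonal x"
        by (auto simp: Q_def algebra_simps)
    qed
    also have "\<dots> = 2 * rtg a (6 * b) b (N - b)"
      unfolding rtg_def by (rule card_bool_times)
    finally show ?thesis .
  qed
  finally show ?thesis .
qed

text \<open>The factor 4 comes from two bits: \<open>r\<close> makes the first index natural, while
  \<open>s\<close> adjusts the parity of the second.\<close>

lemma card_triangular_pentagonal:
  "card {(x, y, n). N = a * int_triangular x + 3 * b * int_triangular y + b * pentagonal n}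
    = 4 * tpg a (2 * b) b N"
proof -
  let ?f = "\<lambda>(r, s, l, m, n). (reflect r (int l), reflect s (m + n), n - m) :: int \<times> int \<times> int"
  let ?Q = "\<lambda>(x, y, n). N = a * int_triangular x + 3 * b * int_triangular y + b * pentagonal n"
  have "card {t. ?Q t} = card {t. ?Q (?f t)}"
  proof (rule card_substitution)
    have *: "r = r' \<and> s = s' \<and> l = l' \<and> m = m' \<and> n = n'"
      if eqs: "reflect r (int l) = reflect r' (int l')"
        "reflect s (m + n) = reflect s' (m' + n')" "n - m = n' - m'"
      for r s l m n r' s' l' m' n'
    proof -
      have "r = r' \<and> l = l'"
        using injD[OF bij_is_inj[OF bij_reflect_int], of "(r, l)" "(r', l')"] eqs by simp
      moreover have "s = s' \<and> m = m' \<and> n = n'"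
      proof (cases "s = s'")
        case True
        then show ?thesis using eqs by (auto simp: reflect_def split: if_splits)
      next
        case False
        \<comment> \<open>Distinct bits would make \<open>m + n\<close> and \<open>m' + n'\<close>
          differ in parity, although \<open>n - m = n' - m'\<close> makes their parities
          agree.\<close>
        then have "(m + n) + (m' + n') = - 1"
          using eqs by (auto simp: reflect_def split: if_splits)
        then show ?thesis using eqs(3) by presburger
      qed
      ultimately show ?thesis by simp
    qed
    show "inj ?f"
      by (simp only: inj_def split_paired_All prod.case prod.inject)
        (intro allI impI, elim conjE, drule (2) *, simp)
    fix t :: "int \<times> int \<times> int"
    obtain x y k where t: "t = (x, y, k)" by (cases t)
    obtain r l where x: "x = reflect r (int l)"
      using bij_is_surj[OF bij_reflect_int] by (auto dest: surjD[of _ x])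
    \<comment> \<open>Reflect exactly when \<open>y\<close> and \<open>k\<close> differ in parity,
      so that half their sum and half their difference become integers.\<close>
    define s where "s = odd (y + k)"
    have "even (reflect s y + k)" by (simp add: s_def reflect_def)
    then obtain n m where "reflect s y = n + m" "k = n - m" by (rule even_sum_in_range)
    moreover have "reflect s (reflect s y) = y" by (simp add: reflect_def)
    ultimately have "t = ?f (r, s, l, m, n)" by (simp add: t x add.commute)
    then show "t \<in> range ?f" by (rule range_eqI)
  qed
  also have "\<dots> = card {(r :: bool, t). case t of (s :: bool, t) \<Rightarrow> (case t of
      (l, m, n) \<Rightarrow> N = a * triangular l + 2 * b * pentagonal m + b * octagonal n)}"
  proof (intro arg_cong[where f = card] Collect_cong, clarsimp)
    fix l m n
    have "b * (3 * int_triangular (m + n) + pentagonal (n - m))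
        = b * (2 * pentagonal m + octagonal n)"
      by (simp only: int_triangular_add_pentagonal)
    then show "N = a * int_triangular (int l) + 3 * b * int_triangular (m + n)
          + b * pentagonal (n - m) \<longleftrightarrow>
        N = a * triangular l + 2 * b * pentagonal m + b * octagonal n"
      by (simp add: triangular_eq algebra_simps)
  qed
  also have "\<dots> = 4 * tpg a (2 * b) b N"
    unfolding card_bool_times tpg_def by simp
  finally show ?thesis .
qed

text \<open>An odd target makes \<open>l + m\<close> odd, so the squares sum to 1 modulo 4 and the
  right-hand side is 3 modulo 4.\<close>

lemma Rp_4_add_1: "Rp 3 3 4 (4 * N + 1) = 0"
proof -
  have "4 * N + 1 \<noteq> 3 * l\<^sup>2 + 3 * m\<^sup>2 + 4 * k" for l m k :: int
  proof
    assume eq: "4 * N + 1 = 3 * l\<^sup>2 + 3 * m\<^sup>2 + 4 * k"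
    have "odd (3 * l\<^sup>2 + 3 * m\<^sup>2 + 4 * k)" by (simp flip: eq)
    then have "odd (l + m)" by simp
    then obtain x y where "l = x + y + 1" "m = x - y" by (rule odd_sum_in_range)
    then show False
      using eq int_triangular_pythagoras[of x y] by presburger
  qed
  then have "{(l, m, n). 4 * N + 1 = 3 * l\<^sup>2 + 3 * m\<^sup>2 + 4 * pentagonal n} = {}" by auto
  then show ?thesis unfolding Rp_def by (simp only: card.empty)
qed

theorem theorem5p13:
  fixes N :: int
  assumes "N \<ge> 0"
  shows "int (Rp 3 3 4 (2 * N)) = int (rP 3 1 1 N) - 2 * int (rtg 3 6 1 (N - 1)) \<and>
    Rp 3 3 4 (4 * N + 3) = 4 * tpg 3 2 1 N \<and>
    Rp 3 3 4 (4 * N + 1) = 0"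
proof (intro conjI)
  show "int (Rp 3 3 4 (2 * N)) = int (rP 3 1 1 N) - 2 * int (rtg 3 6 1 (N - 1))"
    using Rp_even[of 3 2 N] rP_eq_Rp_add_rtg[of 3 1 N] by simp
  show "Rp 3 3 4 (4 * N + 3) = 4 * tpg 3 2 1 N"
    using Rp_odd[of 3 1 N] card_triangular_pentagonal[of N 3 1] by simp
  show "Rp 3 3 4 (4 * N + 1) = 0"
    by (rule Rp_4_add_1)
qed

end
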